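(* The following identity holds: \[ \sum_{n=0}^{\infty} \frac{(\frac12)_n\, (\frac13)_n\, (\frac23)_n\, (\frac16)_n\, (\frac56)_n }{n!^5} \left(-\frac{3^6}{4^6}\right)^n \bigl(1930n^2+549n+45\bigr) = \frac{384}{\pi^2}. \]
   Context: Here $(a)_n$ denotes the rising factorial (Pochhammer symbol): $(a)_0=1$ and $(a)_n=a(a+1)\cdots(a+n-1)$ for positive integers $n$. *)

theory Defs
  imports "HOL-Analysis.Analysis"
begin

end

theory Submission
  imports Defs "HOL-Real_Asymp.Real_Asymp"
begin

text \<open>
The proof is by a Wilf-Zeilberger pair. The series is embedded into a family
\<open>\<Sum>n. wz_G n k\<close>, \<open>k = 0, 1, 2, ...\<close>, of rapidly convergent series: for \<open>k = 0\<close> it is the given series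
divided by \<open>1536\<close> (\<open>wz_G_k_0\<close>, \<open>ray_k_0\<close>), and there is a companion \<open>wz_F\<close> with
\<open>wz_F (n + 1) k - wz_F n k = wz_G n (k + 1) - wz_G n k\<close> (\<open>wz_pair\<close>). As \<open>wz_F 0 k = 0\<close> and
\<open>wz_F n k\<close> tends to \<open>0\<close> for growing \<open>n\<close>, the sum is the same for every \<open>k\<close> (\<open>suminf_wz_G\<close>).
For growing \<open>k\<close> all terms except the one with \<open>n = 0\<close> disappear, and that term tends to
\<open>1 / (4 pi\<^sup>2)\<close> by the Wallis product (\<open>wz_G_0_tendsto\<close>). Hence the series equals
\<open>1536 / (4 pi\<^sup>2) = 384 / pi\<^sup>2\<close>.

The pair is found in a three-dimensional lattice. Dougall's summation of the bilateral series
\<open>5H5\<close> yields a closed discrete one-form \<open>(step_a, step_b, step_p)\<close> whose components are single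
hypergeometric terms (\<open>square_ab\<close>, \<open>square_ap\<close>, \<open>square_bp\<close>), and any two directions in the lattice
give a WZ pair by integration of the form. The polynomial \<open>1930 n\<^sup>2 + 549 n + 45\<close> is what the four
unit steps of the direction \<open>(1, 2, 1)\<close> add up to. The passages to the limit rest on one
inequality for the term ratio, \<open>ray_ratio_le\<close>.
\<close>

section \<open>A closed discrete one-form\<close>

text \<open>The rational multiples of \<open>lattice_term\<close> below are the three components of a closed discrete
one-form on the points \<open>(a, b, p)\<close>. They come from Dougall's bilateral \<open>5H5\<close> sum: divided by its
closed form (up to trigonometric factors), the very well-poised summand with parameters depending
on \<open>a\<close>, \<open>b\<close>, \<open>p\<close> is odd under reflection of the summation index, here a half-integer, and the
components are, up to a common factor, the increments of its sum over the positive half-integers. Since each increment of the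
summand telescopes in that index, only a boundary term is left, which is a hypergeometric term
without a sum. The factors \<open>(1/2)\<^sub>m\<close> are what remains of the Gamma functions at half-integers.\<close>

definition lattice_term :: "nat \<Rightarrow> nat \<Rightarrow> nat \<Rightarrow> real" where
  "lattice_term a b p = (-1) ^ p * (pochhammer (1/2) p)\<^sup>2
      * pochhammer (1/2) (2 * a - p) * pochhammer (1/2) (2 * b - p) * fact (a + b)
      / (4 ^ (a + b) * fact p * fact (a + b - p) * (fact a)\<^sup>2 * (fact b)\<^sup>2)"

text \<open>The increments when \<open>a\<close>, \<open>b\<close> or \<open>p\<close> grows by one. The value \<open>0\<close> that \<open>step_a\<close> and \<open>step_b\<close> take
at \<open>a = b = p = 0\<close> through \<open>0 / 0 = 0\<close> is the one that they have on the whole plane \<open>p = 0\<close>.\<close>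

definition step_a :: "nat \<Rightarrow> nat \<Rightarrow> nat \<Rightarrow> real" where
  "step_a a b p = lattice_term a b p * (real p * (real b)\<^sup>2 / (2 * (real a + real b)))"

definition step_b :: "nat \<Rightarrow> nat \<Rightarrow> nat \<Rightarrow> real" where
  "step_b a b p = step_a b a p"

definition step_p :: "nat \<Rightarrow> nat \<Rightarrow> nat \<Rightarrow> real" where
  "step_p a b p = lattice_term a b p * (2 * (real a + real b - real p) * (real a)\<^sup>2 * (real b)\<^sup>2
      / ((real a + real b) * (2 * real a - real p - 1/2) * (2 * real b - real p - 1/2)))"

lemma lattice_term_commute: "lattice_term a b p = lattice_term b a p"
  by (simp add: lattice_term_def add.commute mult_ac)

lemma step_p_commute: "step_p a b p = step_p b a p"
  by (simp add: step_p_def lattice_term_commute[of a b] add.commute mult_ac)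

lemma lattice_term_Suc_a:
  assumes "p \<le> 2 * a" "p \<le> a + b"
  shows "lattice_term (Suc a) b p = lattice_term a b p *
    ((2 * real a - real p + 1/2) * (2 * real a - real p + 3/2) * (real a + real b + 1)
      / (4 * (real a + real b + 1 - real p) * (real a + 1)\<^sup>2))"
proof -
  have 1: "2 * Suc a - p = Suc (Suc (2 * a - p))" "Suc (a + b) - p = Suc (a + b - p)"
    using assms by auto
  have 2: "real (2 * a - p) = 2 * real a - real p" "real (a + b - p) = real a + real b - real p"
    using assms by (simp_all add: of_nat_diff)
  have regroup: "s * (x * c * d) * y * (e * f) / (4 * w * g * (m * h) * (n * u)\<^sup>2 * v)
      = s * x * y * f / (w * g * h * u\<^sup>2 * v) * (c * d * e / (4 * m * n\<^sup>2))"
    for s x y c d e f w g h m n u v :: real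
    by (simp add: power_mult_distrib mult_ac)
  have "lattice_term (Suc a) b p = (-1) ^ p * (pochhammer (1/2) p)\<^sup>2
      * (pochhammer (1/2) (2 * a - p) * (2 * real a - real p + 1/2) * (2 * real a - real p + 3/2))
      * pochhammer (1/2) (2 * b - p) * ((real a + real b + 1) * fact (a + b))
      / (4 * 4 ^ (a + b) * fact p * ((real a + real b + 1 - real p) * fact (a + b - p))
         * ((real a + 1) * fact a)\<^sup>2 * (fact b)\<^sup>2)"
    unfolding lattice_term_def add_Suc 1 pochhammer_Suc fact_Suc of_nat_Suc 2 power_Suc of_nat_add
    by (simp add: add_ac diff_add_eq)
  then show ?thesis unfolding lattice_term_def regroup .
qed

lemma lattice_term_Suc_b:
  assumes "p \<le> 2 * b" "p \<le> a + b"
  shows "lattice_term a (Suc b) p = lattice_term a b p *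
    ((2 * real b - real p + 1/2) * (2 * real b - real p + 3/2) * (real a + real b + 1)
      / (4 * (real a + real b + 1 - real p) * (real b + 1)\<^sup>2))"
  using lattice_term_Suc_a[of p b a] assms by (simp add: lattice_term_commute[of a] add.commute)

lemma lattice_term_Suc_p:
  assumes "p < 2 * a" "p < 2 * b"
  shows "lattice_term a b (Suc p) = - lattice_term a b p *
    ((real p + 1/2)\<^sup>2 * (real a + real b - real p)
      / ((real p + 1) * (2 * real a - real p - 1/2) * (2 * real b - real p - 1/2)))"
proof -
  have 1: "2 * a - p = Suc (2 * a - Suc p)" "2 * b - p = Suc (2 * b - Suc p)"
          "a + b - p = Suc (a + b - Suc p)"
    using assms by auto
  have 2: "real (2 * a - Suc p) = 2 * real a - real p - 1" "real (2 * b - Suc p) = 2 * real b - real p - 1"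
          "real (a + b - Suc p) = real a + real b - real p - 1"
    using assms by (simp_all add: of_nat_diff)
  have 3: "2 * real a - real p - 1/2 > 0" "2 * real b - real p - 1/2 > 0" "real a + real b - real p > 0"
    using assms by linarith+
  have regroup: "- s * (q * r)\<^sup>2 * x * y * f / (w * (l * g) * h * u * v)
      = - (s * q\<^sup>2 * (x * c) * (y * d) * f / (w * g * (m * h) * u * v)) * (r\<^sup>2 * m / (l * c * d))"
    if "c \<noteq> 0" "d \<noteq> 0" "m \<noteq> 0" for s q r x y f w l g h u v c d m :: real
    using that by (simp add: power_mult_distrib divide_simps)
  have "lattice_term a b (Suc p) = - ((-1) ^ p) * (pochhammer (1/2) p * (real p + 1/2))\<^sup>2
      * pochhammer (1/2) (2 * a - Suc p) * pochhammer (1/2) (2 * b - Suc p) * fact (a + b)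
      / (4 ^ (a + b) * ((real p + 1) * fact p) * fact (a + b - Suc p) * (fact a)\<^sup>2 * (fact b)\<^sup>2)"
    unfolding lattice_term_def pochhammer_Suc fact_Suc of_nat_Suc power_Suc by (simp add: add_ac)
  also have "\<dots> = - ((-1) ^ p * (pochhammer (1/2) p)\<^sup>2
      * (pochhammer (1/2) (2 * a - Suc p) * (2 * real a - real p - 1/2))
      * (pochhammer (1/2) (2 * b - Suc p) * (2 * real b - real p - 1/2)) * fact (a + b)
      / (4 ^ (a + b) * fact p * ((real a + real b - real p) * fact (a + b - Suc p)) * (fact a)\<^sup>2 * (fact b)\<^sup>2))
      * ((real p + 1/2)\<^sup>2 * (real a + real b - real p)
      / ((real p + 1) * (2 * real a - real p - 1/2) * (2 * real b - real p - 1/2)))"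
    by (rule regroup) (use 3 in auto)
  also have "(-1) ^ p * (pochhammer (1/2) p)\<^sup>2
      * (pochhammer (1/2) (2 * a - Suc p) * (2 * real a - real p - 1/2))
      * (pochhammer (1/2) (2 * b - Suc p) * (2 * real b - real p - 1/2)) * fact (a + b)
      / (4 ^ (a + b) * fact p * ((real a + real b - real p) * fact (a + b - Suc p)) * (fact a)\<^sup>2 * (fact b)\<^sup>2)
      = lattice_term a b p"
    unfolding lattice_term_def 1 pochhammer_Suc fact_Suc of_nat_Suc 2 by simp
  finally show ?thesis .
qed

text \<open>Closedness on the coordinate squares: both ways around a square give the same increment. After
division by the common hypergeometric factor each is an identity between rational functions.\<close>

lemma square_ab:
  assumes "p \<le> 2 * a" "p \<le> 2 * b" "p \<le> a + b" "a + b > 0"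
  shows "step_a a b p + step_b (Suc a) b p = step_b a b p + step_a a (Suc b) p"
proof -
  have rational: "P * B\<^sup>2 / (2 * (A + B))
      + (2*A - P + 1/2) * (2*A - P + 3/2) * (A + B + 1) / (4 * (A + B + 1 - P) * (A + 1)\<^sup>2)
          * (P * (A + 1)\<^sup>2 / (2 * (B + (A + 1))))
    = P * A\<^sup>2 / (2 * (B + A))
      + (2*B - P + 1/2) * (2*B - P + 3/2) * (A + B + 1) / (4 * (A + B + 1 - P) * (B + 1)\<^sup>2)
          * (P * (B + 1)\<^sup>2 / (2 * (A + (B + 1))))"
    if "A \<ge> 0" "B \<ge> 0" "A + B > 0" "A + B + 1 - P > 0" for A B P :: real
  proof -
    have nz: "A + 1 \<noteq> 0" "B + 1 \<noteq> 0" "A + B \<noteq> 0" "A + B + 1 \<noteq> 0" "A + B + 1 - P \<noteq> 0"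
      using that by linarith+
    have "(2*A - P + 1/2) * (2*A - P + 3/2) * (A + B + 1) / (4 * (A + B + 1 - P) * (A + 1)\<^sup>2)
          * (P * (A + 1)\<^sup>2 / (2 * (B + (A + 1))))
        = P * (2*A - P + 1/2) * (2*A - P + 3/2) / (8 * (A + B + 1 - P))"
      using nz by (simp add: divide_simps) (simp add: algebra_simps)
    moreover have "(2*B - P + 1/2) * (2*B - P + 3/2) * (A + B + 1) / (4 * (A + B + 1 - P) * (B + 1)\<^sup>2)
          * (P * (B + 1)\<^sup>2 / (2 * (A + (B + 1))))
        = P * (2*B - P + 1/2) * (2*B - P + 3/2) / (8 * (A + B + 1 - P))"
      using nz by (simp add: divide_simps) (simp add: algebra_simps)
    moreover have "P * B\<^sup>2 / (2 * (A + B)) = P * A\<^sup>2 / (2 * (B + A)) + P * (B - A) / 2"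
      using nz by (simp add: divide_simps add.commute) (simp add: algebra_simps power2_eq_square)
    moreover have "P * (2*B - P + 1/2) * (2*B - P + 3/2) / (8 * (A + B + 1 - P))
        = P * (2*A - P + 1/2) * (2*A - P + 3/2) / (8 * (A + B + 1 - P)) + P * (B - A) / 2"
      using nz by (simp add: divide_simps) (simp add: algebra_simps power2_eq_square)
    ultimately show ?thesis by simp
  qed
  have pos: "real a + real b > 0" "real a + real b + 1 - real p > 0"
    using assms by linarith+
  show ?thesis
    using arg_cong[OF rational[OF of_nat_0_le_iff of_nat_0_le_iff pos], of "\<lambda>x. lattice_term a b p * x"]
    unfolding step_b_def step_a_def lattice_term_commute[of b a] lattice_term_commute[of b "Suc a"]
      lattice_term_Suc_a[OF assms(1,3)] lattice_term_Suc_b[OF assms(2,3)]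
    by (simp only: distrib_left mult.assoc of_nat_Suc add.commute[of 1])
qed

lemma square_ap:
  assumes "p < 2 * a" "p < 2 * b" "p \<le> a + b"
  shows "step_a a b p + step_p (Suc a) b p = step_p a b p + step_a a b (Suc p)"
proof -
  have rational: "P * B\<^sup>2 / (2 * (A + B))
      + (2*A - P + 1/2) * (2*A - P + 3/2) * (A + B + 1) / (4 * (A + B + 1 - P) * (A + 1)\<^sup>2)
          * (2 * (A + 1 + B - P) * (A + 1)\<^sup>2 * B\<^sup>2 / ((A + 1 + B) * (2*(A + 1) - P - 1/2) * (2*B - P - 1/2)))
    = 2 * (A + B - P) * A\<^sup>2 * B\<^sup>2 / ((A + B) * (2*A - P - 1/2) * (2*B - P - 1/2))
      + - ((P + 1/2)\<^sup>2 * (A + B - P) / ((P + 1) * (2*A - P - 1/2) * (2*B - P - 1/2)))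
          * ((P + 1) * B\<^sup>2 / (2 * (A + B)))"
    if "P \<ge> 0" "2 * A - P - 1/2 > 0" "2 * B - P - 1/2 > 0" for A B P :: real
  proof -
    \<comment> \<open>In these coordinates the identity reduces to a factorization of \<open>4 A\<^sup>2 - (P + 1/2)\<^sup>2\<close>.\<close>
    define X Y where "X = 2 * A - P - 1/2" and "Y = 2 * B - P - 1/2"
    have AB: "A = (X + P + 1/2) / 2" "B = (Y + P + 1/2) / 2" by (simp_all add: X_def Y_def)
    have nz: "A + 1 \<noteq> 0" "P + 1 \<noteq> 0" "A + B \<noteq> 0" "A + B + 1 \<noteq> 0" "A + B + 1 - P \<noteq> 0" "X \<noteq> 0" "Y \<noteq> 0" "X + 2 \<noteq> 0"
      using that by (auto simp: X_def Y_def)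
    have "(2*A - P + 1/2) * (2*A - P + 3/2) * (A + B + 1) / (4 * (A + B + 1 - P) * (A + 1)\<^sup>2)
          * (2 * (A + 1 + B - P) * (A + 1)\<^sup>2 * B\<^sup>2 / ((A + 1 + B) * (2*(A + 1) - P - 1/2) * (2*B - P - 1/2)))
        = ((X + 1) * (X + 2) * (A + B + 1) / (4 * (A + B + 1 - P) * (A + 1)\<^sup>2))
          * (2 * (A + B + 1 - P) * (A + 1)\<^sup>2 * B\<^sup>2 / ((A + B + 1) * (X + 2) * Y))"
      by (simp add: X_def Y_def algebra_simps)
    also have "\<dots> = (X + 1) * B\<^sup>2 / (2 * Y)"
      using nz by (simp add: divide_simps)
    finally have 1: "(2*A - P + 1/2) * (2*A - P + 3/2) * (A + B + 1) / (4 * (A + B + 1 - P) * (A + 1)\<^sup>2)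
          * (2 * (A + 1 + B - P) * (A + 1)\<^sup>2 * B\<^sup>2 / ((A + 1 + B) * (2*(A + 1) - P - 1/2) * (2*B - P - 1/2)))
        = (X + 1) * B\<^sup>2 / (2 * Y)" .
    have 2: "((P + 1/2)\<^sup>2 * (A + B - P) / ((P + 1) * X * Y)) * ((P + 1) * B\<^sup>2 / (2 * (A + B)))
        = (P + 1/2)\<^sup>2 * (A + B - P) * B\<^sup>2 / (2 * (A + B) * X * Y)"
      using nz by (simp add: divide_simps)
    have "P * B\<^sup>2 / (2 * (A + B)) + (X + 1) * B\<^sup>2 / (2 * Y)
        = B\<^sup>2 * (P * Y + (X + 1) * (A + B)) / (2 * (A + B) * Y)"
      using nz by (simp add: divide_simps) (simp add: algebra_simps)
    also have "P * Y + (X + 1) * (A + B) = (A + B - P) * (X + 2 * P + 1)"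
      unfolding AB by (simp add: field_simps)
    also have "B\<^sup>2 * ((A + B - P) * (X + 2 * P + 1)) / (2 * (A + B) * Y)
        = B\<^sup>2 * (A + B - P) * (X * (X + 2 * P + 1)) / (2 * (A + B) * X * Y)"
      using nz by (simp add: divide_simps)
    also have "X * (X + 2 * P + 1) = 4 * A\<^sup>2 - (P + 1/2)\<^sup>2"
      unfolding AB by (simp add: field_simps power2_eq_square)
    also have "B\<^sup>2 * (A + B - P) * (4 * A\<^sup>2 - (P + 1/2)\<^sup>2) / (2 * (A + B) * X * Y)
        = 2 * (A + B - P) * A\<^sup>2 * B\<^sup>2 / ((A + B) * X * Y)
          - (P + 1/2)\<^sup>2 * (A + B - P) * B\<^sup>2 / (2 * (A + B) * X * Y)"
      using nz by (simp add: divide_simps) (simp add: algebra_simps)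
    finally show ?thesis using 1 2 by (simp add: X_def Y_def)
  qed
  have pos: "2 * real a - real p - 1/2 > 0" "2 * real b - real p - 1/2 > 0"
    using assms by linarith+
  have p': "p \<le> 2 * a" using assms by simp
  show ?thesis
    using arg_cong[OF rational[OF of_nat_0_le_iff pos], of "\<lambda>x. lattice_term a b p * x"]
    unfolding step_a_def step_p_def lattice_term_Suc_p[OF assms(1,2)] lattice_term_Suc_a[OF p' assms(3)]
    by (simp only: distrib_left mult.assoc mult_minus_left mult_minus_right of_nat_Suc add.commute[of 1])
qed

lemma square_bp:
  assumes "p < 2 * a" "p < 2 * b" "p \<le> a + b"
  shows "step_b a b p + step_p a (Suc b) p = step_p a b p + step_b a b (Suc p)"
  using square_ap[of p b a] assms by (simp add: step_b_def step_p_commute add.commute)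

section \<open>The WZ pair\<close>

text \<open>Start at \<open>(n + k, 2 n + k, n)\<close>. The function \<open>wz_F\<close> integrates the form along \<open>(1, 1, 0)\<close>, which
raises \<open>k\<close>, and \<open>wz_G\<close> integrates it along \<open>(1, 2, 1)\<close>, which raises \<open>n\<close>. The direction of \<open>n\<close>
is the one whose term ratio at \<open>k = 0\<close> tends to \<open>- 3\<^sup>6 / 4\<^sup>6\<close>; that of \<open>k\<close> lets \<open>a\<close> and \<open>b\<close> both
grow, so that for large \<open>k\<close> every term with positive \<open>n\<close> is negligible.\<close>

definition wz_F :: "nat \<Rightarrow> nat \<Rightarrow> real" where
  "wz_F n k = step_a (n + k) (2 * n + k) n + step_b (Suc (n + k)) (2 * n + k) n"

definition wz_G :: "nat \<Rightarrow> nat \<Rightarrow> real" where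
  "wz_G n k = step_a (n + k) (2 * n + k) n + step_b (Suc (n + k)) (2 * n + k) n
     + step_b (Suc (n + k)) (Suc (2 * n + k)) n + step_p (Suc (n + k)) (Suc (Suc (2 * n + k))) n"

text \<open>Rearranged without subtraction, the claim is that the form has the same sum along the paths
A B A B B P and A B B P A B, where a letter stands for a unit step in that coordinate. After the common prefix A B, the three squares
used here turn one path into the other.\<close>

lemma wz_pair: "wz_F (Suc n) k - wz_F n k = wz_G n (Suc k) - wz_G n k"
proof -
  define a b where "a = Suc (n + k)" and "b = Suc (2 * n + k)"
  have "step_a a b n + step_b (Suc a) b n = step_b a b n + step_a a (Suc b) n"
    by (rule square_ab) (auto simp: a_def b_def)
  moreover have "step_a a (Suc b) n + step_p (Suc a) (Suc b) n
      = step_p a (Suc b) n + step_a a (Suc b) (Suc n)"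
    by (rule square_ap) (auto simp: a_def b_def)
  moreover have "step_b (Suc a) (Suc b) n + step_p (Suc a) (Suc (Suc b)) n
      = step_p (Suc a) (Suc b) n + step_b (Suc a) (Suc b) (Suc n)"
    by (rule square_bp) (auto simp: a_def b_def)
  ultimately show ?thesis
    by (simp add: wz_F_def wz_G_def a_def b_def)
qed

definition ray :: "nat \<Rightarrow> nat \<Rightarrow> real" where
  "ray n k = lattice_term (n + k) (2 * n + k) n"

text \<open>From here on every quantity is a rational multiple of \<open>ray n k\<close>. The abbreviations satisfy
\<open>2 a - p + 1/2 = c\<close>, \<open>2 b - p + 1/2 = d\<close>, \<open>a + b = s\<close> and \<open>a + b - p = r\<close> with \<open>p = n\<close>, so the factors
produced by unit steps are integer shifts of \<open>c\<close>, \<open>d\<close>, \<open>s\<close> and \<open>r\<close>.\<close>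

context
  fixes n k :: nat and x y a b c d s r :: real
  defines "x \<equiv> real n" and "y \<equiv> real k"
  defines "a \<equiv> x + y" and "b \<equiv> 2 * x + y" and "c \<equiv> x + 2 * y + 1/2" and "d \<equiv> 3 * x + 2 * y + 1/2"
    and "s \<equiv> 3 * x + 2 * y" and "r \<equiv> 2 * x + 2 * y"
begin

lemma nonneg: "x \<ge> 0" "y \<ge> 0" "a \<ge> 0" "b \<ge> 0" "c > 0" "d > 0" "s \<ge> 0" "r \<ge> 0"
  by (simp_all add: x_def y_def a_def b_def c_def d_def s_def r_def)

lemma lattice_term_1: "lattice_term (Suc (n + k)) (2 * n + k) n
    = ray n k * (c * (c + 1) * (s + 1) / (4 * (r + 1) * (a + 1)\<^sup>2))"
  unfolding ray_def
  by (subst lattice_term_Suc_a)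
    (auto simp: x_def y_def a_def b_def c_def d_def s_def r_def algebra_simps)

lemma lattice_term_2: "lattice_term (Suc (n + k)) (Suc (2 * n + k)) n
    = ray n k * (c * (c + 1) * (s + 1) / (4 * (r + 1) * (a + 1)\<^sup>2))
        * (d * (d + 1) * (s + 2) / (4 * (r + 2) * (b + 1)\<^sup>2))"
  unfolding lattice_term_1[symmetric]
  by (subst lattice_term_Suc_b)
    (auto simp: x_def y_def a_def b_def c_def d_def s_def r_def algebra_simps)

lemma lattice_term_3: "lattice_term (Suc (n + k)) (Suc (Suc (2 * n + k))) n
    = ray n k * (c * (c + 1) * (s + 1) / (4 * (r + 1) * (a + 1)\<^sup>2))
        * (d * (d + 1) * (s + 2) / (4 * (r + 2) * (b + 1)\<^sup>2))
        * ((d + 2) * (d + 3) * (s + 3) / (4 * (r + 3) * (b + 2)\<^sup>2))"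
  unfolding lattice_term_2[symmetric]
  by (subst lattice_term_Suc_b)
    (auto simp: x_def y_def a_def b_def c_def d_def s_def r_def algebra_simps)

lemma ray_Suc: "ray (Suc n) k = - (ray n k *
    ((x + 1/2)\<^sup>2 * c * ((s + 1) * (s + 2) * (s + 3)) * (d * (d + 1) * (d + 2))
     / (64 * (r + 1) * (r + 2) * (a + 1)\<^sup>2 * (b + 1)\<^sup>2 * (b + 2)\<^sup>2 * (x + 1))))"
proof -
  have step: "ray (Suc n) k = - (lattice_term (Suc (n + k)) (Suc (Suc (2 * n + k))) n
      * ((x + 1/2)\<^sup>2 * (r + 3) / ((x + 1) * (c + 1) * (d + 3))))"
  proof -
    have "real (Suc (n + k)) + real (Suc (Suc (2 * n + k))) - real n = r + 3"
      "2 * real (Suc (n + k)) - real n - 1/2 = c + 1"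
      "2 * real (Suc (Suc (2 * n + k))) - real n - 1/2 = d + 3"
      by (simp_all add: x_def y_def c_def d_def r_def)
    moreover have "Suc n + k = Suc (n + k)" "2 * Suc n + k = Suc (Suc (2 * n + k))"
      by simp_all
    ultimately show ?thesis
      using lattice_term_Suc_p[of n "Suc (n + k)" "Suc (Suc (2 * n + k))"]
      by (simp add: ray_def x_def)
  qed
  have regroup: "K * (c * c1 * s1 / (4 * r1 * a1)) * (d * d1 * s2 / (4 * r2 * b1))
        * (d2 * d3 * s3 / (4 * r3 * b2)) * (h * r3 / (x1 * c1 * d3))
      = K * (h * c * (s1 * s2 * s3) * (d * d1 * d2) / (64 * r1 * r2 * a1 * b1 * b2 * x1))"
    if "c1 \<noteq> 0" "d3 \<noteq> 0" "r3 \<noteq> 0" for K c1 s1 r1 a1 d1 s2 r2 b1 d2 d3 s3 r3 b2 h x1 :: real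
    using that by (simp add: divide_simps)
  show ?thesis
    unfolding step lattice_term_3 by (subst regroup) (use nonneg in auto)
qed

lemma step_a_ray: "step_a (n + k) (2 * n + k) n = ray n k * (x * b\<^sup>2 / (2 * (a + b)))"
  by (simp add: step_a_def ray_def x_def y_def a_def b_def)

lemma step_b_ray: "step_b (Suc (n + k)) (2 * n + k) n
    = ray n k * (x * (c * (c + 1)) / (8 * (r + 1)))"
proof -
  have "step_b (Suc (n + k)) (2 * n + k) n
      = lattice_term (Suc (n + k)) (2 * n + k) n * (x * (a + 1)\<^sup>2 / (2 * (s + 1)))"
    by (simp add: step_b_def step_a_def lattice_term_commute x_def y_def a_def b_def s_def algebra_simps)
  also have "\<dots> = ray n k * (x * (c * (c + 1)) / (8 * (r + 1)))"
    unfolding lattice_term_1 using nonneg by (simp add: divide_simps) (simp add: algebra_simps)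
  finally show ?thesis .
qed

lemma wz_F_ray: "wz_F n k = ray n k * (x * b\<^sup>2 / (2 * (a + b)) + x * (c * (c + 1)) / (8 * (r + 1)))"
  by (simp add: wz_F_def step_a_ray step_b_ray distrib_left)

lemma wz_G_ray: "wz_G n k = ray n k *
    (x * b\<^sup>2 / (2 * (a + b)) + x * (c * (c + 1)) / (8 * (r + 1))
     + x * (c * (c + 1) * (s + 1) * d * (d + 1)) / (32 * ((r + 1) * (r + 2) * (b + 1)\<^sup>2))
     + c * (s + 1) * (s + 2) * d * (d + 1) * (d + 2) / (32 * ((r + 1) * (r + 2) * (b + 1)\<^sup>2)))"
proof -
  have "step_b (Suc (n + k)) (Suc (2 * n + k)) n
      = lattice_term (Suc (n + k)) (Suc (2 * n + k)) n * (x * (a + 1)\<^sup>2 / (2 * (s + 2)))"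
    by (simp add: step_b_def step_a_def lattice_term_commute x_def y_def a_def b_def s_def algebra_simps)
  also have "\<dots> = ray n k * (x * (c * (c + 1) * (s + 1) * d * (d + 1)) / (32 * ((r + 1) * (r + 2) * (b + 1)\<^sup>2)))"
    unfolding lattice_term_2 using nonneg by (simp add: divide_simps) (simp add: algebra_simps)
  finally have 1: "step_b (Suc (n + k)) (Suc (2 * n + k)) n = \<dots>" .
  have "step_p (Suc (n + k)) (Suc (Suc (2 * n + k))) n
      = lattice_term (Suc (n + k)) (Suc (Suc (2 * n + k))) n
          * (2 * (r + 3) * (a + 1)\<^sup>2 * (b + 2)\<^sup>2 / ((s + 3) * (c + 1) * (d + 3)))"
    by (simp add: step_p_def x_def y_def a_def b_def c_def d_def s_def r_def algebra_simps)
  also have "\<dots> = ray n k * (c * (s + 1) * (s + 2) * d * (d + 1) * (d + 2) / (32 * ((r + 1) * (r + 2) * (b + 1)\<^sup>2)))"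
    unfolding lattice_term_3 using nonneg by (simp add: divide_simps) (simp add: algebra_simps)
  finally have 2: "step_p (Suc (n + k)) (Suc (Suc (2 * n + k))) n = \<dots>" .
  show ?thesis
    unfolding wz_G_def step_a_ray step_b_ray 1 2 by (simp add: distrib_left)
qed

section \<open>Uniform geometric bounds\<close>

text \<open>For large arguments the ratio is about \<open>n (n + 2 k) / (4 a\<^sup>2)\<close> times the square of
\<open>(a + b)\<^sup>3 / (8 a b\<^sup>2)\<close>, and \<open>(a + b)\<^sup>3 \<le> 8 a b\<^sup>2\<close> because \<open>a \<le> b \<le> 2 a\<close>. With the exact shifts
this is the inequality with \<open>M\<close> below, where the difference of the two sides is a polynomial in
\<open>n\<close> and \<open>k\<close> with positive coefficients. The bound is at most \<open>1/2\<close> for all \<open>n\<close> and \<open>k\<close>, which makes the convergence in \<open>n\<close>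
uniform, and it is of order \<open>1 / k\<close> for \<open>n = 0\<close>, which makes the tail vanish as \<open>k\<close> grows.\<close>

lemma ray_ratio_le:
  "(x + 1/2)\<^sup>2 * c * ((s + 1) * (s + 2) * (s + 3)) * (d * (d + 1) * (d + 2))
     / (64 * (r + 1) * (r + 2) * (a + 1)\<^sup>2 * (b + 1)\<^sup>2 * (b + 2)\<^sup>2 * (x + 1))
   \<le> (x + 1) / (2 * (a + 1))"
proof -
  define M where "M = 8 * (a + 1) * (b + 1) * (b + 2)"
  have M: "M > 0" using nonneg by (simp add: M_def)
  have "M - (s + 1) * (s + 2) * (s + 3)
      = 5*x^3 + 10*x\<^sup>2*y + 4*x*y\<^sup>2 + 26*x\<^sup>2 + 32*x*y + 8*y\<^sup>2 + 31*x + 18*y + 10"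
    by (simp add: M_def a_def b_def s_def algebra_simps power2_eq_square power3_eq_cube)
  also have "\<dots> \<ge> 0" using nonneg by simp
  finally have S1: "(s + 1) * (s + 2) * (s + 3) \<le> M" by simp
  have ds: "d = s + 1/2" by (simp add: d_def s_def)
  have "d * (d + 1) * (d + 2) \<le> (s + 1) * (s + 2) * (s + 3)"
    unfolding ds using nonneg by (intro mult_mono) auto
  with S1 have S2: "d * (d + 1) * (d + 2) \<le> M" by simp
  have num: "(x + 1/2)\<^sup>2 * c * ((s + 1) * (s + 2) * (s + 3)) * (d * (d + 1) * (d + 2))
      \<le> (x + 1)\<^sup>2 * (r + 1) * M * M"
    using S1 S2 nonneg M
    by (intro mult_mono power_mono mult_nonneg_nonneg) (auto simp: c_def r_def x_def y_def)
  have den: "64 * (r + 1) * (r + 2) * (a + 1)\<^sup>2 * (b + 1)\<^sup>2 * (b + 2)\<^sup>2 * (x + 1)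
      = 2 * (r + 1) * (a + 1) * M * M * (x + 1)"
    by (simp add: M_def a_def r_def) (simp add: algebra_simps power2_eq_square)
  have pos: "2 * (r + 1) * (a + 1) * M * M * (x + 1) > 0"
    using nonneg M by simp
  have "(x + 1/2)\<^sup>2 * c * ((s + 1) * (s + 2) * (s + 3)) * (d * (d + 1) * (d + 2))
     / (64 * (r + 1) * (r + 2) * (a + 1)\<^sup>2 * (b + 1)\<^sup>2 * (b + 2)\<^sup>2 * (x + 1))
     \<le> (x + 1)\<^sup>2 * (r + 1) * M * M / (2 * (r + 1) * (a + 1) * M * M * (x + 1))"
    unfolding den by (rule divide_right_mono[OF num less_imp_le[OF pos]])
  also have "\<dots> = (x + 1) / (2 * (a + 1))"
  proof -
    have nz: "x + 1 \<noteq> 0" "r + 1 \<noteq> 0" "M \<noteq> 0" "a + 1 \<noteq> 0" using nonneg M by auto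
    show ?thesis using nz by (simp add: divide_simps power2_eq_square) (simp add: algebra_simps)
  qed
  finally show ?thesis .
qed

lemma abs_ray_Suc_le: "\<bar>ray (Suc n) k\<bar> \<le> (x + 1) / (2 * (a + 1)) * \<bar>ray n k\<bar>"
  unfolding ray_Suc abs_minus abs_mult
  by (subst mult.commute, rule mult_right_mono, subst abs_of_nonneg)
    (use ray_ratio_le nonneg in auto)

text \<open>With \<open>m = n + k + 1\<close> the four summands of \<open>wz_G_ray\<close> are at most \<open>m\<^sup>2\<close> times
\<open>1\<close>, \<open>1/2\<close>, \<open>27/16\<close> and \<open>243/32\<close>, which add up to less than \<open>12\<close>.\<close>

lemma abs_wz_F_le: "\<bar>wz_F n k\<bar> \<le> 12 * (a + 1)\<^sup>2 * \<bar>ray n k\<bar>"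
  and abs_wz_G_le: "\<bar>wz_G n k\<bar> \<le> 12 * (a + 1)\<^sup>2 * \<bar>ray n k\<bar>"
proof -
  define m where "m = a + 1"
  have m: "m > 0" "x \<le> m" "b \<le> 2 * m" "c \<le> 2 * m" "c + 1 \<le> 2 * m" "m \<le> b + 1" "m \<le> r + 1" "2 * m = r + 2"
    "s + 1 \<le> 3 * m" "s + 2 \<le> 3 * m" "d \<le> 3 * m" "d + 1 \<le> 3 * m" "d + 2 \<le> 3 * m"
    using nonneg unfolding m_def by (auto simp: a_def b_def c_def d_def s_def r_def)
  have "x * b\<^sup>2 / (2 * (a + b)) \<le> m\<^sup>2"
  proof (cases "a + b = 0")
    case False
    then have ab: "a + b > 0" using nonneg by auto
    have "x * b\<^sup>2 \<le> m * ((2 * m) * (a + b))"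
      unfolding power2_eq_square using nonneg m by (intro mult_mono) auto
    then show ?thesis using ab by (simp add: divide_le_eq power2_eq_square mult_ac)
  qed simp
  moreover have "x * (c * (c + 1)) / (8 * (r + 1)) \<le> m * ((2 * m) * (2 * m)) / (8 * m)"
    using nonneg m by (intro frac_le mult_mono mult_nonneg_nonneg) auto
  moreover have "x * (c * (c + 1) * (s + 1) * d * (d + 1)) / (32 * ((r + 1) * (r + 2) * (b + 1)\<^sup>2))
      \<le> m * ((2 * m) * (2 * m) * (3 * m) * (3 * m) * (3 * m)) / (32 * (m * (2 * m) * m\<^sup>2))"
    using nonneg m by (intro frac_le mult_mono mult_nonneg_nonneg power_mono) auto
  moreover have "c * (s + 1) * (s + 2) * d * (d + 1) * (d + 2) / (32 * ((r + 1) * (r + 2) * (b + 1)\<^sup>2))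
      \<le> (2 * m) * (3 * m) * (3 * m) * (3 * m) * (3 * m) * (3 * m) / (32 * (m * (2 * m) * m\<^sup>2))"
    using nonneg m by (intro frac_le mult_mono mult_nonneg_nonneg power_mono) auto
  moreover have "m * ((2 * m) * (2 * m)) / (8 * m) = m\<^sup>2 / 2"
    "m * ((2 * m) * (2 * m) * (3 * m) * (3 * m) * (3 * m)) / (32 * (m * (2 * m) * m\<^sup>2)) = 27/16 * m\<^sup>2"
    "(2 * m) * (3 * m) * (3 * m) * (3 * m) * (3 * m) * (3 * m) / (32 * (m * (2 * m) * m\<^sup>2)) = 243/32 * m\<^sup>2"
    using m(1) by (simp_all add: divide_simps power2_eq_square)
  moreover have "0 \<le> x * b\<^sup>2 / (2 * (a + b))" "0 \<le> x * (c * (c + 1)) / (8 * (r + 1))"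
    "0 \<le> x * (c * (c + 1) * (s + 1) * d * (d + 1)) / (32 * ((r + 1) * (r + 2) * (b + 1)\<^sup>2))"
    "0 \<le> c * (s + 1) * (s + 2) * d * (d + 1) * (d + 2) / (32 * ((r + 1) * (r + 2) * (b + 1)\<^sup>2))"
    using nonneg by auto
  moreover have "m\<^sup>2 \<ge> 0" by simp
  ultimately have bounds:
    "\<bar>x * b\<^sup>2 / (2 * (a + b)) + x * (c * (c + 1)) / (8 * (r + 1))\<bar> \<le> 12 * m\<^sup>2"
    "\<bar>x * b\<^sup>2 / (2 * (a + b)) + x * (c * (c + 1)) / (8 * (r + 1))
     + x * (c * (c + 1) * (s + 1) * d * (d + 1)) / (32 * ((r + 1) * (r + 2) * (b + 1)\<^sup>2))
     + c * (s + 1) * (s + 2) * d * (d + 1) * (d + 2) / (32 * ((r + 1) * (r + 2) * (b + 1)\<^sup>2))\<bar> \<le> 12 * m\<^sup>2"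
    by linarith+
  show "\<bar>wz_F n k\<bar> \<le> 12 * (a + 1)\<^sup>2 * \<bar>ray n k\<bar>" "\<bar>wz_G n k\<bar> \<le> 12 * (a + 1)\<^sup>2 * \<bar>ray n k\<bar>"
    unfolding wz_F_ray wz_G_ray m_def[symmetric] abs_mult mult.commute[of "12 * m\<^sup>2"]
    by (rule mult_left_mono[OF bounds(1) abs_ge_zero], rule mult_left_mono[OF bounds(2) abs_ge_zero])
qed

end

lemma abs_ray_le: "\<bar>ray n k\<bar> \<le> \<bar>ray 0 k\<bar> / 2 ^ n"
proof (induction n)
  case (Suc n)
  have "\<bar>ray (Suc n) k\<bar> \<le> (real n + 1) / (2 * (real n + real k + 1)) * \<bar>ray n k\<bar>"
    by (rule abs_ray_Suc_le)
  also have "\<dots> \<le> 1 / 2 * (\<bar>ray 0 k\<bar> / 2 ^ n)"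
    using Suc.IH by (intro mult_mono) (auto simp: divide_simps)
  finally show ?case by simp
qed simp

lemma abs_ray_Suc_le_weighted: "\<bar>ray (Suc n) k\<bar> \<le> \<bar>ray 0 k\<bar> / (2 * (real k + 1) * 2 ^ n)"
proof (induction n)
  case 0
  show ?case using abs_ray_Suc_le[of 0 k] by (simp add: add.commute)
next
  case (Suc n)
  have "\<bar>ray (Suc (Suc n)) k\<bar>
      \<le> (real (Suc n) + 1) / (2 * (real (Suc n) + real k + 1)) * \<bar>ray (Suc n) k\<bar>"
    by (rule abs_ray_Suc_le)
  also have "\<dots> \<le> 1 / 2 * (\<bar>ray 0 k\<bar> / (2 * (real k + 1) * 2 ^ n))"
    using Suc.IH by (intro mult_mono) (auto simp: divide_simps)
  finally show ?case by (simp add: mult_ac)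
qed

lemma square_sum_le: "(real n + real k + 1)\<^sup>2 \<le> (real n + 1)\<^sup>2 * (real k + 1)\<^sup>2"
  unfolding power_mult_distrib[symmetric] by (intro power_mono) (auto simp: algebra_simps)

lemma summable_square_over_two_power: "summable (\<lambda>n. (real n + 2)\<^sup>2 / 2 ^ n)"
proof (rule summable_comparison_test_bigo[where g = "\<lambda>n. inverse (real n ^ 2)"])
  show "(\<lambda>n. (real n + 2)\<^sup>2 / 2 ^ n) \<in> O(\<lambda>n. inverse (real n ^ 2))" by real_asymp
qed (simp add: inverse_power_summable)

lemma abs_wz_G_Suc_le:
  "\<bar>wz_G (Suc n) k\<bar> \<le> 6 * ((real k + 1) * \<bar>ray 0 k\<bar>) * ((real n + 2)\<^sup>2 / 2 ^ n)"
proof -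
  have "\<bar>wz_G (Suc n) k\<bar> \<le> 12 * (real (Suc n) + real k + 1)\<^sup>2 * \<bar>ray (Suc n) k\<bar>"
    by (rule abs_wz_G_le)
  also have "\<dots> \<le> 12 * ((real (Suc n) + 1)\<^sup>2 * (real k + 1)\<^sup>2)
      * (\<bar>ray 0 k\<bar> / (2 * (real k + 1) * 2 ^ n))"
    by (intro mult_mono square_sum_le abs_ray_Suc_le_weighted) auto
  also have "\<dots> = 6 * ((real k + 1) * \<bar>ray 0 k\<bar>) * ((real n + 2)\<^sup>2 / 2 ^ n)"
    by (simp add: divide_simps power2_eq_square add_ac)
  finally show ?thesis .
qed

lemma summable_wz_G: "summable (\<lambda>n. wz_G n k)"
proof -
  have "summable (\<lambda>n. 6 * ((real k + 1) * \<bar>ray 0 k\<bar>) * ((real n + 2)\<^sup>2 / 2 ^ n))"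
    by (intro summable_mult summable_square_over_two_power)
  then have "summable (\<lambda>n. wz_G (Suc n) k)"
    by (rule summable_comparison_test'[where N = 0]) (simp only: real_norm_def abs_wz_G_Suc_le)
  then show ?thesis by (rule summable_Suc_iff[THEN iffD1])
qed

lemma wz_F_tendsto_0: "(\<lambda>n. wz_F n k) \<longlonglongrightarrow> 0"
proof (rule Lim_null_comparison)
  show "\<forall>\<^sub>F n in sequentially. norm (wz_F n k) \<le> 12 * \<bar>ray 0 k\<bar> * ((real n + real k + 1)\<^sup>2 / 2 ^ n)"
  proof (intro always_eventually allI)
    fix n
    have "\<bar>wz_F n k\<bar> \<le> 12 * (real n + real k + 1)\<^sup>2 * \<bar>ray n k\<bar>"
      by (rule abs_wz_F_le)
    also have "\<dots> \<le> 12 * (real n + real k + 1)\<^sup>2 * (\<bar>ray 0 k\<bar> / 2 ^ n)"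
      by (intro mult_left_mono abs_ray_le) auto
    finally show "norm (wz_F n k) \<le> 12 * \<bar>ray 0 k\<bar> * ((real n + real k + 1)\<^sup>2 / 2 ^ n)"
      by (simp add: mult_ac)
  qed
  have "(\<lambda>n. (real n + real k + 1)\<^sup>2 / 2 ^ n) \<longlonglongrightarrow> 0" by real_asymp
  then show "(\<lambda>n. 12 * \<bar>ray 0 k\<bar> * ((real n + real k + 1)\<^sup>2 / 2 ^ n)) \<longlonglongrightarrow> 0"
    by (rule tendsto_mult_right_zero)
qed

lemma wz_F_0: "wz_F 0 k = 0"
  by (simp add: wz_F_def step_b_def step_a_def)

section \<open>The sum is independent of k\<close>

text \<open>Summing the WZ relation over \<open>n\<close> telescopes \<open>wz_F\<close>, which vanishes at both ends.\<close>

lemma suminf_wz_G_Suc: "(\<Sum>n. wz_G n (Suc k)) = (\<Sum>n. wz_G n k)"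
proof -
  have "(\<lambda>n. wz_G n (Suc k) - wz_G n k) sums (0 - wz_F 0 k)"
    unfolding wz_pair[symmetric] by (rule telescope_sums[OF wz_F_tendsto_0])
  moreover have "(\<lambda>n. wz_G n (Suc k) - wz_G n k) sums ((\<Sum>n. wz_G n (Suc k)) - (\<Sum>n. wz_G n k))"
    by (intro sums_diff summable_sums summable_wz_G)
  ultimately show ?thesis by (auto dest: sums_unique2 simp: wz_F_0)
qed

lemma suminf_wz_G: "(\<Sum>n. wz_G n k) = (\<Sum>n. wz_G n 0)"
  by (induction k) (simp_all only: suminf_wz_G_Suc)

section \<open>Evaluation as k tends to infinity\<close>

definition wallis_quotient :: "nat \<Rightarrow> real" where
  "wallis_quotient n = real n * (pochhammer (1/2) n / fact n)\<^sup>2"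

lemma wallis_quotient_tendsto: "wallis_quotient \<longlonglongrightarrow> 1 / pi"
proof -
  have "(\<lambda>n. ((real n / (real n + 1/2)) / Gamma_series (1/2) n)\<^sup>2) \<longlonglongrightarrow> (1 / Gamma (1/2 :: real))\<^sup>2"
    by (intro tendsto_power tendsto_divide Gamma_series_LIMSEQ) (real_asymp, simp add: Gamma_one_half_real)
  moreover have "((real n / (real n + 1/2)) / Gamma_series (1/2) n)\<^sup>2 = wallis_quotient n" if "n > 0" for n
  proof -
    have "exp (1/2 * ln (real n)) = sqrt (real n)"
      using that by (simp add: powr_half_sqrt[symmetric] powr_def)
    then have "Gamma_series (1/2 :: real) n = fact n * sqrt (real n) / (pochhammer (1/2) n * (real n + 1/2))"
      by (simp add: Gamma_series_def pochhammer_Suc add.commute)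
    moreover have "real n + 1/2 \<noteq> 0" by linarith
    ultimately have "(real n / (real n + 1/2)) / Gamma_series (1/2) n
        = real n * pochhammer (1/2) n / (fact n * sqrt (real n))"
      by simp
    then show ?thesis
      using that by (simp add: wallis_quotient_def power_divide power_mult_distrib) (simp add: power2_eq_square)
  qed
  then have "\<forall>\<^sub>F n in sequentially. ((real n / (real n + 1/2)) / Gamma_series (1/2) n)\<^sup>2 = wallis_quotient n"
    by (intro eventually_mono[OF eventually_gt_at_top[of 0]])
  ultimately have "wallis_quotient \<longlonglongrightarrow> (1 / Gamma (1/2 :: real))\<^sup>2"
    by (rule Lim_transform_eventually)
  then show ?thesis by (simp add: Gamma_one_half_real power_divide)
qed

text \<open>The duplication \<open>(2 k)! = 4\<^sup>k k! (1/2)\<^sub>k\<close> turns the term with \<open>n = 0\<close> into two Wallis quotients, each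
contributing one factor \<open>1 / pi\<close> in the limit.\<close>

lemma ray_0_wallis_quotient:
  assumes "k > 0"
  shows "ray 0 k = wallis_quotient (2 * k) * wallis_quotient k / (2 * (real k)\<^sup>2)"
proof -
  have "ray 0 k = (pochhammer (1/2) (2 * k) / (4 ^ k * (fact k)\<^sup>2))\<^sup>2"
    by (simp add: ray_def lattice_term_def power_divide power_mult_distrib power_mult[symmetric] mult_2 
        power2_eq_square power_add mult_ac)
  also have "4 ^ k * (fact k)\<^sup>2 = fact (2 * k) * fact k / (pochhammer (1/2) k :: real)"
    using pochhammer_pos[of "1/2 :: real" k]
    by (simp add: fact_double power_mult power2_eq_square)
  finally show ?thesis
    using assms by (simp add: wallis_quotient_def power2_eq_square mult_ac)
qed

lemma ray_0_tendsto: "(\<lambda>k. (real k)\<^sup>2 * ray 0 k) \<longlonglongrightarrow> 1 / (2 * pi\<^sup>2)"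
proof -
  have "filterlim (\<lambda>k::nat. 2 * k) sequentially sequentially"
    by (rule filterlim_subseq) (simp add: strict_mono_def)
  then have "(\<lambda>k. wallis_quotient (2 * k) * wallis_quotient k / 2) \<longlonglongrightarrow> 1 / pi * (1 / pi) / 2"
    by (intro tendsto_divide tendsto_mult wallis_quotient_tendsto filterlim_compose[OF wallis_quotient_tendsto]) auto
  moreover have "\<forall>\<^sub>F k in sequentially. wallis_quotient (2 * k) * wallis_quotient k / 2 = (real k)\<^sup>2 * ray 0 k"
    by (intro eventually_mono[OF eventually_gt_at_top[of 0]]) (simp add: ray_0_wallis_quotient)
  ultimately have "(\<lambda>k. (real k)\<^sup>2 * ray 0 k) \<longlonglongrightarrow> 1 / pi * (1 / pi) / 2"
    by (rule Lim_transform_eventually)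
  then show ?thesis by (simp add: power2_eq_square mult_ac)
qed

lemma wz_G_0_tendsto: "(\<lambda>k. wz_G 0 k) \<longlonglongrightarrow> 1 / (4 * pi\<^sup>2)"
proof -
  \<comment> \<open>\<open>h\<close> is the rational factor of \<open>wz_G 0 k\<close> divided by \<open>k\<^sup>2\<close>.\<close>
  define h where "h k = (2*k + 1/2)\<^sup>2 * (2*k + 3/2) * (2*k + 5/2) / (32 * k\<^sup>2 * (k + 1)\<^sup>2)" for k :: real
  have "(\<lambda>k. h (real k)) \<longlonglongrightarrow> 1/2"
    unfolding h_def by real_asymp
  with ray_0_tendsto have "(\<lambda>k. (real k)\<^sup>2 * ray 0 k * h (real k)) \<longlonglongrightarrow> 1 / (2 * pi\<^sup>2) * (1/2)"
    by (rule tendsto_mult)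
  moreover have "(real k)\<^sup>2 * ray 0 k * h (real k) = wz_G 0 k" if "k > 0" for k
  proof -
    have "wz_G 0 k = ray 0 k * ((2 * real k + 1/2) * (2 * real k + 1) * (2 * real k + 2) * (2 * real k + 1/2)
        * (2 * real k + 3/2) * (2 * real k + 5/2) / (32 * ((2 * real k + 1) * (2 * real k + 2) * (real k + 1)\<^sup>2)))"
      unfolding wz_G_ray by (simp add: add_ac)
    also have "(2 * real k + 1/2) * (2 * real k + 1) * (2 * real k + 2) * (2 * real k + 1/2)
        * (2 * real k + 3/2) * (2 * real k + 5/2) / (32 * ((2 * real k + 1) * (2 * real k + 2) * (real k + 1)\<^sup>2))
        = (real k)\<^sup>2 * h (real k)"
    proof -
      have "c * p * q * c * d * e / (32 * (p * q * w)) = z * (c\<^sup>2 * d * e / (32 * z * w))"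
        if "p \<noteq> 0" "q \<noteq> 0" "z \<noteq> 0" for c p q d e w z :: real
        using that by (simp add: divide_simps power2_eq_square)
      then show ?thesis using that by (simp add: h_def power2_eq_square)
    qed
    finally show ?thesis by (simp add: mult_ac)
  qed
  then have "\<forall>\<^sub>F k in sequentially. (real k)\<^sup>2 * ray 0 k * h (real k) = wz_G 0 k"
    by (intro eventually_mono[OF eventually_gt_at_top[of 0]])
  ultimately show ?thesis
    by (auto dest: Lim_transform_eventually)
qed

text \<open>The tail beyond \<open>n = 0\<close> is of order \<open>k ray 0 k\<close>, hence \<open>O(1 / k)\<close>, so the constant value of the
sum is the limit of its first term.\<close>

lemma suminf_wz_G_eq: "(\<Sum>n. wz_G n 0) = 1 / (4 * pi\<^sup>2)"
proof -
  define Z where "Z = (\<Sum>n. (real n + 2)\<^sup>2 / 2 ^ n)"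
  have tail: "\<bar>\<Sum>n. wz_G (Suc n) k\<bar> \<le> 6 * ((real k + 1) * \<bar>ray 0 k\<bar>) * Z" for k
  proof -
    have "norm (\<Sum>n. wz_G (Suc n) k) \<le> (\<Sum>n. 6 * ((real k + 1) * \<bar>ray 0 k\<bar>) * ((real n + 2)\<^sup>2 / 2 ^ n))"
      by (rule norm_suminf_le)
        (simp only: real_norm_def abs_wz_G_Suc_le, intro summable_mult summable_square_over_two_power)
    then show ?thesis
      unfolding Z_def by (simp only: suminf_mult[OF summable_square_over_two_power] real_norm_def)
  qed
  have "(\<lambda>k. (real k)\<^sup>2 * ray 0 k * ((real k + 1) / (real k)\<^sup>2)) \<longlonglongrightarrow> 1 / (2 * pi\<^sup>2) * 0"
    by (intro tendsto_mult ray_0_tendsto) real_asymp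
  moreover have "\<forall>\<^sub>F k in sequentially.
      (real k)\<^sup>2 * ray 0 k * ((real k + 1) / (real k)\<^sup>2) = (real k + 1) * ray 0 k"
    by (intro eventually_mono[OF eventually_gt_at_top[of 0]]) simp
  ultimately have "(\<lambda>k. (real k + 1) * ray 0 k) \<longlonglongrightarrow> 0"
    by (auto dest: Lim_transform_eventually)
  then have "(\<lambda>k. 6 * \<bar>(real k + 1) * ray 0 k\<bar> * Z) \<longlonglongrightarrow> 0"
    by (intro tendsto_mult_left_zero tendsto_mult_right_zero tendsto_rabs_zero)
  then have "(\<lambda>k. \<Sum>n. wz_G (Suc n) k) \<longlonglongrightarrow> 0"
    by (rule Lim_null_comparison[rotated])
      (use tail in \<open>auto simp: abs_mult intro!: always_eventually\<close>)
  with wz_G_0_tendsto have "(\<lambda>k. wz_G 0 k + (\<Sum>n. wz_G (Suc n) k)) \<longlonglongrightarrow> 1 / (4 * pi\<^sup>2) + 0"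
    by (rule tendsto_add)
  moreover have "wz_G 0 k + (\<Sum>n. wz_G (Suc n) k) = (\<Sum>n. wz_G n 0)" for k
    using suminf_split_head[OF summable_wz_G[of k]] suminf_wz_G[of k] by simp
  ultimately show ?thesis by (simp add: LIMSEQ_const_iff)
qed

section \<open>Identification with the series\<close>

text \<open>Triplication: \<open>pochhammer (1/2) (3 n)\<close> supplies the parameters \<open>1/6, 1/2, 5/6\<close>, and \<open>(3 n)!\<close> supplies
\<open>1/3, 2/3, 1\<close>.\<close>

lemma pochhammer_product:
  "pochhammer (1/2 :: real) (3 * n) * fact (3 * n)
    = 729 ^ n * (pochhammer (1/2) n * pochhammer (1/3) n * pochhammer (2/3) n
        * pochhammer (1/6) n * pochhammer (5/6) n) * fact n"
proof (induction n)
  case (Suc n)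
  have 3: "3 * Suc n = Suc (Suc (Suc (3 * n)))" by simp
  have "pochhammer (1/2 :: real) (3 * Suc n) * fact (3 * Suc n)
      = (pochhammer (1/2) (3 * n) * fact (3 * n))
        * ((1/2 + 3 * real n) * (3/2 + 3 * real n) * (5/2 + 3 * real n)
           * ((3 * real n + 1) * (3 * real n + 2) * (3 * real n + 3)))"
  proof -
    have "1/2 + real (3 * n) = 1/2 + 3 * real n" "1/2 + real (Suc (3 * n)) = 3/2 + 3 * real n"
      "1/2 + real (Suc (Suc (3 * n))) = 5/2 + 3 * real n"
      "real (Suc (3 * n)) = 3 * real n + 1" "real (Suc (Suc (3 * n))) = 3 * real n + 2"
      "real (Suc (Suc (Suc (3 * n)))) = 3 * real n + 3"
      by simp_all
    then show ?thesis
      unfolding 3 pochhammer_Suc fact_Suc by (simp only: mult_ac)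
  qed
  also have "(1/2 + 3 * real n) * (3/2 + 3 * real n) * (5/2 + 3 * real n)
           * ((3 * real n + 1) * (3 * real n + 2) * (3 * real n + 3))
      = 729 * ((1/2 + real n) * (1/3 + real n) * (2/3 + real n) * (1/6 + real n) * (5/6 + real n))
          * (1 + real n)"
    by (simp add: field_simps)
  finally show ?case
    unfolding Suc.IH pochhammer_Suc fact_Suc power_Suc of_nat_Suc by (simp only: mult_ac)
qed simp

lemma ray_k_0:
  "ray n 0 = (pochhammer (1/2) n * pochhammer (1/3) n * pochhammer (2/3) n
      * pochhammer (1/6) n * pochhammer (5/6) n) / fact n ^ 5 * (- (3^6 / 4^6)) ^ n"
proof -
  define P where "P = pochhammer (1/2 :: real) n"
  have P: "P > 0" unfolding P_def by (rule pochhammer_pos) simp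
  have "ray n 0 = (-1) ^ n * P\<^sup>2 * P * (pochhammer (1/2) (3 * n) * fact (3 * n))
      / (4 ^ (3 * n) * fact n * fact (2 * n) * (fact n)\<^sup>2 * (fact (2 * n))\<^sup>2)"
    by (simp add: ray_def lattice_term_def P_def mult_2 mult_ac)
  also have "\<dots> = (pochhammer (1/2) n * pochhammer (1/3) n * pochhammer (2/3) n
      * pochhammer (1/6) n * pochhammer (5/6) n) / fact n ^ 5
      * ((-1) ^ n * 729 ^ n / (64 ^ n * 4 ^ n * 4 ^ n * 4 ^ n))"
    unfolding pochhammer_product fact_double P_def[symmetric] power_mult
    using P by (simp add: divide_simps power2_eq_square eval_nat_numeral)
  also have "(-1) ^ n * 729 ^ n / (64 ^ n * 4 ^ n * 4 ^ n * 4 ^ n) = (- (3^6 / 4^6) :: real) ^ n"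
    by (simp flip: power_mult_distrib power_divide)
  finally show ?thesis .
qed

text \<open>The last two summands of \<open>wz_G_ray\<close> have the denominator \<open>(2 n + 1)\<^sup>3 (n + 1)\<close>. Their sum is a
polynomial because \<open>n + 1/2\<close> and \<open>3 n + 3/2\<close> are multiples of \<open>2 n + 1\<close> and the rest combines to
\<open>n (n + 3/2) + (3 n + 2) (3 n + 5/2) = 5 (2 n + 1) (n + 1)\<close>.\<close>

lemma wz_G_k_0: "wz_G n 0 = ray n 0 * (1930 * real n ^ 2 + 549 * real n + 45) / 1536"
proof -
  have rational: "x * (2 * x)\<^sup>2 / (2 * (x + 2 * x)) + x * ((x + 1/2) * (x + 1/2 + 1)) / (8 * (2 * x + 1))
      + x * ((x + 1/2) * (x + 1/2 + 1) * (3 * x + 1) * (3 * x + 1/2) * (3 * x + 1/2 + 1))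
          / (32 * ((2 * x + 1) * (2 * x + 2) * (2 * x + 1)\<^sup>2))
      + (x + 1/2) * (3 * x + 1) * (3 * x + 2) * (3 * x + 1/2) * (3 * x + 1/2 + 1) * (3 * x + 1/2 + 2)
          / (32 * ((2 * x + 1) * (2 * x + 2) * (2 * x + 1)\<^sup>2))
      = (1930 * x\<^sup>2 + 549 * x + 45) / 1536"
    if "x \<ge> 0" for x :: real
  proof -
    define z where "z = 2 * x + 1"
    have nz: "z \<noteq> 0" "x + 1 \<noteq> 0" using that by (auto simp: z_def)
    have halves: "x + 1/2 = z / 2" "3 * x + 1/2 + 1 = 3 * z / 2" by (simp_all add: z_def)
    have first: "x * (2 * x)\<^sup>2 / (2 * (x + 2 * x)) = 2 / 3 * x\<^sup>2"
      by (cases "x = 0") (simp_all add: divide_simps power2_eq_square)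
    have second: "x * ((x + 1/2) * (x + 1/2 + 1)) / (8 * z) = x * (x + 3/2) / 16"
      unfolding halves(1) using nz by (simp add: divide_simps) (simp add: z_def algebra_simps)
    have last_two: "x * ((x + 1/2) * (x + 1/2 + 1) * (3 * x + 1) * (3 * x + 1/2) * (3 * x + 1/2 + 1))
          / (32 * (z * (2 * x + 2) * z\<^sup>2))
      + (x + 1/2) * (3 * x + 1) * (3 * x + 2) * (3 * x + 1/2) * (3 * x + 1/2 + 1) * (3 * x + 1/2 + 2)
          / (32 * (z * (2 * x + 2) * z\<^sup>2))
      = 15/256 * (3 * x + 1) * (3 * x + 1/2)"
    proof -
      have "x * ((x + 1/2) * (x + 1/2 + 1) * (3 * x + 1) * (3 * x + 1/2) * (3 * x + 1/2 + 1))
          / (32 * (z * (2 * x + 2) * z\<^sup>2))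
        + (x + 1/2) * (3 * x + 1) * (3 * x + 2) * (3 * x + 1/2) * (3 * x + 1/2 + 1) * (3 * x + 1/2 + 2)
          / (32 * (z * (2 * x + 2) * z\<^sup>2))
        = (x + 1/2) * (3 * x + 1/2 + 1) * (x * (x + 1/2 + 1) + (3 * x + 2) * (3 * x + 1/2 + 2))
          * ((3 * x + 1) * (3 * x + 1/2)) / (32 * (z * (2 * x + 2) * z\<^sup>2))"
      proof -
        have "v * (h * h' * p * d * d') + h * p * q * d * d' * d'' = h * d' * (v * h' + q * d'') * (p * d)"
          for v h h' p q d d' d'' :: real
          by (simp add: algebra_simps)
        then show ?thesis unfolding add_divide_distrib[symmetric] by simp
      qed
      also have "x * (x + 1/2 + 1) + (3 * x + 2) * (3 * x + 1/2 + 2) = 5 * z * (x + 1)"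
        by (simp add: z_def algebra_simps)
      also have "(x + 1/2) * (3 * x + 1/2 + 1) * (5 * z * (x + 1)) * ((3 * x + 1) * (3 * x + 1/2))
            / (32 * (z * (2 * x + 2) * z\<^sup>2))
          = 15/256 * (3 * x + 1) * (3 * x + 1/2)"
      proof -
        have "w / 2 * (3 * w / 2) * (5 * w * v) * t / (32 * (w * (2 * v) * w\<^sup>2)) = 15/256 * t"
          if "w \<noteq> 0" "v \<noteq> 0" for w v t :: real
          using that by (simp add: power2_eq_square)
        moreover have "2 * x + 2 = 2 * (x + 1)" by simp
        ultimately show ?thesis unfolding halves using nz by (simp only: mult.assoc)
      qed
      finally show ?thesis .
    qed
    show ?thesis
      unfolding z_def[symmetric] add.assoc first second[unfolded add.assoc] last_two[unfolded add.assoc]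
      by (simp add: power2_eq_square field_simps)
  qed
  have "wz_G n 0 = ray n 0 * ((1930 * (real n)\<^sup>2 + 549 * real n + 45) / 1536)"
    unfolding rational[OF of_nat_0_le_iff, symmetric] wz_G_ray by simp
  then show ?thesis by simp
qed

theorem mainTheorem2:
  shows "(\<lambda>n::nat.
      (pochhammer (1/2) n * pochhammer (1/3) n * pochhammer (2/3) n
          * pochhammer (1/6) n * pochhammer (5/6) n) / fact n ^ 5
        * (- (3^6 / 4^6)) ^ n * (1930 * real n ^ 2 + 549 * real n + 45))
    sums (384 / pi\<^sup>2)"
proof -
  have "(\<lambda>n. 1536 * wz_G n 0) sums (1536 * (1 / (4 * pi\<^sup>2)))"
    using summable_sums[OF summable_wz_G[of 0]] unfolding suminf_wz_G_eq by (rule sums_mult)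
  then show ?thesis
    unfolding wz_G_k_0 ray_k_0 by simp
qed

end
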